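(* Let $f$, $M$, $l_f$, $L_M$ satisfy A1) and A2), let $x_0\in\mathbb{R}^d$, let $0=t_0<t_1<\dots<t_N=T$ be a grid with step-sizes $h_n=t_{n+1}-t_n$ satisfying A3), and let $\rho_0,\dots,\rho_N>0$ and $\epsilon_0,\dots,\epsilon_{N-1}>0$. Let $\mathcal{S}_\Phi$ be the set of all sequences $\{y_n\}_{n=0}^N$ with $y_0=x_0$ and $y_{n+1}\in\Phi(t_n,y_n;h_n)$ for $n=0,\dots,N-1$, and let $\mathcal{S}_{\hat\Phi}$ be the set of all sequences $\{\hat y_n\}_{n=0}^N$ with $\hat y_0\in P_{\rho_0}(\{x_0\})$ and $\hat y_{n+1}\in\hat\Phi(t_n,\hat y_n;h_n,\rho_{n+1},\epsilon_n)$ for $n=0,\dots,N-1$. Then for every $\{y_n\}_{n=0}^N\in\mathcal{S}_\Phi$ there exists $\{\hat y_n\}_{n=0}^N\in\mathcal{S}_{\hat\Phi}$ such that $$|y_n-\hat y_n|\le\frac{\sqrt d}{2}\rho_0\prod_{k=0}^{n-1}\frac{1+L_M(t_k)h_k}{1-l_f(t_{k+1})h_k}+\frac{\sqrt d}{2}\sum_{k=0}^{n-1}\left(\prod_{j=k+1}^{n-1}\frac{1+L_M(t_j)h_j}{1-l_f(t_{j+1})h_j}\right)\left(\rho_{k+1}+\frac{\epsilon_kh_k}{1-l_f(t_{k+1})h_k}\right)$$ for all $n=0,\dots,N$; and conversely, for every $\{\hat y_n\}_{n=0}^N\in\mathcal{S}_{\hat\Phi}$ there exists $\{y_n\}_{n=0}^N\in\mathcal{S}_\Phi$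 satisfying the same estimate for all $n=0,\dots,N$.
   Context: $|\cdot|$ is the Euclidean norm on $\mathbb{R}^d$. For nonempty compact $A,B\subset\mathbb{R}^d$, $\operatorname{dist}(A,B)=\sup_{a\in A}\inf_{b\in B}|a-b|$ and $\operatorname{dist}_H(A,B)=\max\{\operatorname{dist}(A,B),\operatorname{dist}(B,A)\}$. Let $T>0$. A1) $f:[0,T]\times\mathbb{R}^d\to\mathbb{R}^d$ is continuous and there is a continuous function $l_f:[0,T]\to\mathbb{R}$ such that $\langle f(t,x)-f(t,x'),x-x'\rangle\le l_f(t)|x-x'|^2$ for all $t\in[0,T]$, $x,x'\in\mathbb{R}^d$. A2) $M:[0,T]\times\mathbb{R}^d\to\{\text{nonempty convex compact subsets of }\mathbb{R}^d\}$ is continuous with respect to the Hausdorff metric and there is a continuous function $L_M:[0,T]\to[0,\infty)$ such that $\operatorname{dist}_H(M(t,x),M(t,x'))\le L_M(t)|x-x'|$ for all $t\in[0,T]$, $x,x'\in\mathbb{R}^d$. A3) $l_f(t_{n+1})h_n<1$ for all $n\in\{0,\dots,N-1\}$. The parameterized semi-implicit Euler scheme is $\Phi(t,x;h)=\{z\in\mathbb{R}^d: z\in x+hf(t+h,z)+hM(t,x)\}$. For $\rho>0$ let $\Delta_\rho=\rho\mathbb{Z}^d$, and for $A\subset\mathbb{R}^d$ nonempty let $P_\rho(A)=\{x\in\Delta_\rho:\inf_{a\in A}|x-a|\le\frac{\sqrt d}{2}\rho\}$. The fully discretized scheme is $\hat\Phi(t,x;h,\rho,\epsilon)=P_\rho\left(\{z\in\mathbb{R}^d: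 z\in x+hf(t+h,z)+hP_\epsilon(M(t,x))\}\right)$. Empty products equal $1$ and empty sums equal $0$. *)

theory Defs
  imports "HOL-Analysis.Analysis"
begin

text \<open>On nonempty compact sets the following two functions are the one-sided and the symmetric
  Hausdorff distance; they are only used for such sets.\<close>

definition semidist :: "'a::metric_space set \<Rightarrow> 'a set \<Rightarrow> real" where
  "semidist A B = (SUP a\<in>A. infdist a B)"

definition hausdorff_dist :: "'a::metric_space set \<Rightarrow> 'a set \<Rightarrow> real" where
  "hausdorff_dist A B = max (semidist A B) (semidist B A)"

definition hausdorff_continuous_on ::
  "'a::topological_space set \<Rightarrow> ('a \<Rightarrow> 'b::metric_space set) \<Rightarrow> bool" where
  "hausdorff_continuous_on S F \<longleftrightarrow>
     (\<forall>p\<in>S. ((\<lambda>q. hausdorff_dist (F q) (F p)) \<longlongrightarrow> 0) (at p within S))"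

definition grid :: "real \<Rightarrow> (real ^ 'n) set" where
  "grid \<rho> = range (\<lambda>k :: int ^ 'n. \<rho> *\<^sub>R (\<chi> i. of_int (k $ i)))"

text \<open>Since \<^term>\<open>infdist x {} = 0\<close>, the empty set has to be excluded explicitly; with the
  convention that an infimum over the empty set is infinite it is projected to the empty set.\<close>

definition grid_proj :: "real \<Rightarrow> (real ^ 'n) set \<Rightarrow> (real ^ 'n) set" where
  "grid_proj \<rho> A = {x \<in> grid \<rho>. A \<noteq> {} \<and> infdist x A \<le> sqrt (real CARD('n)) / 2 * \<rho>}"

definition semi_implicit_euler ::
  "(real \<Rightarrow> real ^ 'n \<Rightarrow> real ^ 'n) \<Rightarrow> (real \<Rightarrow> real ^ 'n \<Rightarrow> (real ^ 'n) set)
   \<Rightarrow> real \<Rightarrow> real ^ 'n \<Rightarrow> real \<Rightarrow> (real ^ 'n) set" where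
  "semi_implicit_euler f M t x h =
     {z. z \<in> (\<lambda>m. x + h *\<^sub>R f (t + h) z + h *\<^sub>R m) ` M t x}"

definition discretized_euler ::
  "(real \<Rightarrow> real ^ 'n \<Rightarrow> real ^ 'n) \<Rightarrow> (real \<Rightarrow> real ^ 'n \<Rightarrow> (real ^ 'n) set)
   \<Rightarrow> real \<Rightarrow> real ^ 'n \<Rightarrow> real \<Rightarrow> real \<Rightarrow> real \<Rightarrow> (real ^ 'n) set" where
  "discretized_euler f M t x h \<rho> \<epsilon> =
     grid_proj \<rho> {z. z \<in> (\<lambda>m. x + h *\<^sub>R f (t + h) z + h *\<^sub>R m) ` grid_proj \<epsilon> (M t x)}"

text \<open>A finite sequence with indices \<open>0, \<dots>, N\<close> is represented by a function on the naturals whose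
  values beyond \<open>N\<close> are irrelevant.\<close>

definition euler_solutions ::
  "(real \<Rightarrow> real ^ 'n \<Rightarrow> real ^ 'n) \<Rightarrow> (real \<Rightarrow> real ^ 'n \<Rightarrow> (real ^ 'n) set)
   \<Rightarrow> real ^ 'n \<Rightarrow> nat \<Rightarrow> (nat \<Rightarrow> real) \<Rightarrow> (nat \<Rightarrow> real) \<Rightarrow> (nat \<Rightarrow> real ^ 'n) set" where
  "euler_solutions f M x0 N t h =
     {y. y 0 = x0 \<and> (\<forall>n<N. y (Suc n) \<in> semi_implicit_euler f M (t n) (y n) (h n))}"

definition discretized_solutions ::
  "(real \<Rightarrow> real ^ 'n \<Rightarrow> real ^ 'n) \<Rightarrow> (real \<Rightarrow> real ^ 'n \<Rightarrow> (real ^ 'n) set)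
   \<Rightarrow> real ^ 'n \<Rightarrow> nat \<Rightarrow> (nat \<Rightarrow> real) \<Rightarrow> (nat \<Rightarrow> real) \<Rightarrow> (nat \<Rightarrow> real) \<Rightarrow> (nat \<Rightarrow> real)
   \<Rightarrow> (nat \<Rightarrow> real ^ 'n) set" where
  "discretized_solutions f M x0 N t h \<rho> \<epsilon> =
     {y. y 0 \<in> grid_proj (\<rho> 0) {x0} \<and>
         (\<forall>n<N. y (Suc n) \<in> discretized_euler f M (t n) (y n) (h n) (\<rho> (Suc n)) (\<epsilon> n))}"

definition error_bound ::
  "nat \<Rightarrow> (real \<Rightarrow> real) \<Rightarrow> (real \<Rightarrow> real) \<Rightarrow> (nat \<Rightarrow> real) \<Rightarrow> (nat \<Rightarrow> real) \<Rightarrow> (nat \<Rightarrow> real)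
   \<Rightarrow> (nat \<Rightarrow> real) \<Rightarrow> nat \<Rightarrow> real" where
  "error_bound d l L t h \<rho> \<epsilon> n =
     sqrt (real d) / 2 * \<rho> 0 * (\<Prod>k<n. (1 + L (t k) * h k) / (1 - l (t (Suc k)) * h k)) +
     sqrt (real d) / 2 *
       (\<Sum>k<n. (\<Prod>j\<in>{Suc k..<n}. (1 + L (t j) * h j) / (1 - l (t (Suc j)) * h j)) *
              (\<rho> (Suc k) + \<epsilon> k * h k / (1 - l (t (Suc k)) * h k)))"

end

theory Submission
  imports Defs
begin

text \<open>A dissipative step \<open>z = c + g z\<close> with one-sided Lipschitz constant \<open>\<lambda> < 1\<close> is uniquely
  solvable (by Brouwer's theorem, as \<open>z - g z - c\<close> points outwards on large spheres), and \<open>c \<mapsto> z\<close> is Lipschitz with constant \<open>1 / (1 - \<lambda>)\<close>. Given neighbouring states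
  \<open>x\<close>, \<open>x'\<close> and a step from \<open>x\<close>, the Lipschitz property of \<open>M\<close> provides a velocity in \<open>M(t, x')\<close>
  close to the one used, up to projection onto a grid; solving the implicit equation with it gives
  a step from \<open>x'\<close>. Conversely, a discretized step lies within half a grid diagonal of an actual
  solution because the solution set is closed. The resulting recursive inequality for the error is
  exactly the one the error bound satisfies with equality.\<close>

section \<open>Implicit equations with a one-sided Lipschitz term\<close>

text \<open>Without a zero, \<open>-F\<close> projected radially onto the sphere would be a
  continuous self-map of the ball. Its Brouwer fixed point lies on the sphere, and there
  \<open>F z \<bullet> z\<close> equals \<open>-(r * norm (F z))\<close>, which is negative.\<close>

lemma ex_zero_if_outward_on_sphere:
  fixes F :: "'a::euclidean_space \<Rightarrow> 'a"
  assumes "continuous_on (cball 0 r) F" and "r > 0"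
    and outward: "\<And>z. norm z = r \<Longrightarrow> F z \<bullet> z \<ge> 0"
  shows "\<exists>z\<in>cball 0 r. F z = 0"
proof (rule ccontr)
  assume nz: "\<not> ?thesis"
  let ?G = "\<lambda>z. - ((r / norm (F z)) *\<^sub>R F z)"
  have cont: "continuous_on (cball 0 r) ?G"
    using assms(1) nz by (intro continuous_intros) auto
  have norm_G: "norm (?G z) = r" if "z \<in> cball 0 r" for z
    using nz that \<open>r > 0\<close> by auto
  then have "?G \<in> cball 0 r \<rightarrow> cball 0 r"
    by (intro Pi_I) (metis mem_cball_0 order_refl)
  with \<open>r > 0\<close> cont obtain z where z: "z \<in> cball 0 r" "?G z = z"
    by (rule brouwer_ball)
  have "F z \<noteq> 0" using nz z(1) by blast
  have "norm z = r" using norm_G[OF z(1)] by (simp only: z(2))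
  have "F z \<bullet> z = F z \<bullet> ?G z" by (simp only: z(2))
  also have "\<dots> = - (r * norm (F z))"
    using \<open>F z \<noteq> 0\<close> by (simp add: dot_square_norm power2_eq_square)
  also have "\<dots> < 0" using \<open>F z \<noteq> 0\<close> \<open>r > 0\<close> by simp
  finally show False using outward[OF \<open>norm z = r\<close>] by simp
qed

text \<open>Comparing \<open>z\<close> with 0 in \<open>osl\<close> bounds
  \<open>F z \<bullet> z\<close> on the sphere of radius \<open>r\<close> from below by
  \<open>((1 - lam) * r - norm (F 0)) * r\<close>.\<close>

lemma ex_implicit_solution:
  fixes g :: "'a::euclidean_space \<Rightarrow> 'a"
  assumes cont: "continuous_on UNIV g"
    and osl: "\<And>x y. (g x - g y) \<bullet> (x - y) \<le> lam * (norm (x - y))\<^sup>2"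
    and "lam < 1"
  shows "\<exists>z. z = c + g z"
proof -
  define F where "F = (\<lambda>z. z - g z - c)"
  \<comment> \<open>This radius turns \<open>(1 - lam) * r - norm (F 0)\<close> into
    \<open>1 - lam\<close>, which is positive; the summand 1 keeps \<open>r\<close> positive even
    when \<open>F 0 = 0\<close>.\<close>
  define r where "r = norm (F 0) / (1 - lam) + 1"
  have "r > 0" using \<open>lam < 1\<close> by (simp add: r_def add_nonneg_pos)
  have "F z \<bullet> z \<ge> 0" if "norm z = r" for z
  proof -
    have "F z \<bullet> z = z \<bullet> z - (g z - g 0) \<bullet> (z - 0) + F 0 \<bullet> z"
      by (simp add: F_def algebra_simps)
    moreover have "(g z - g 0) \<bullet> (z - 0) \<le> lam * r\<^sup>2" using osl[of z 0] that by simp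
    moreover have "- (norm (F 0) * r) \<le> F 0 \<bullet> z"
      using Cauchy_Schwarz_ineq2[of "F 0" z] that by simp
    moreover have "z \<bullet> z = r\<^sup>2" using that by (simp add: dot_square_norm)
    ultimately have "F z \<bullet> z \<ge> ((1 - lam) * r - norm (F 0)) * r"
      by (simp add: algebra_simps power2_eq_square)
    moreover have "(1 - lam) * r - norm (F 0) = 1 - lam"
      using \<open>lam < 1\<close> by (simp add: r_def field_simps)
    ultimately show ?thesis using \<open>lam < 1\<close> \<open>r > 0\<close>
      by (smt (verit) mult_nonneg_nonneg)
  qed
  moreover have "continuous_on (cball 0 r) F"
    unfolding F_def by (intro continuous_intros continuous_on_subset[OF cont]) auto
  ultimately obtain z where "F z = 0"
    using ex_zero_if_outward_on_sphere \<open>r > 0\<close> by blast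
  then show ?thesis by (auto simp: F_def algebra_simps)
qed

text \<open>Test the difference of the two equations with \<open>z - z'\<close>, apply
  Cauchy-Schwarz to the data term and cancel one factor \<open>norm (z - z')\<close>; hence the
  separate case of equal solutions.\<close>

lemma implicit_solution_stable:
  fixes g :: "'a::real_inner \<Rightarrow> 'a"
  assumes osl: "(g z - g z') \<bullet> (z - z') \<le> lam * (norm (z - z'))\<^sup>2"
    and z: "z = c + g z" and z': "z' = c' + g z'"
  shows "(1 - lam) * norm (z - z') \<le> norm (c - c')"
proof (cases "z = z'")
  case False
  have "z - z' = (c - c') + (g z - g z')"
    by (subst z, subst z') simp
  then have "(z - z') \<bullet> (z - z') = (c - c') \<bullet> (z - z') + (g z - g z') \<bullet> (z - z')"
    by (metis inner_add_left)
  also have "\<dots> \<le> norm (c - c') * norm (z - z') + lam * (norm (z - z'))\<^sup>2"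
    using osl norm_cauchy_schwarz by (rule add_mono[rotated])
  finally have "((1 - lam) * norm (z - z')) * norm (z - z') \<le> norm (c - c') * norm (z - z')"
    by (simp add: dot_square_norm algebra_simps power2_eq_square)
  then show ?thesis using False by (simp add: mult_le_cancel_right)
qed simp

section \<open>Distances to sets and the Hausdorff distance\<close>

lemma infdist_attained_le:
  fixes A :: "'a::heine_borel set"
  assumes "closed A" "A \<noteq> {}" "infdist x A \<le> r"
  obtains a where "a \<in> A" "dist x a \<le> r"
proof -
  obtain a where "a \<in> A" "infdist x A = dist x a"
    using infdist_attains_inf[OF assms(1,2)] .
  then show ?thesis using that assms(3) by simp
qed

lemma infdist_le_hausdorff_dist:
  assumes "compact A" "a \<in> A"
  shows "infdist a B \<le> hausdorff_dist A B"
proof -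
  \<comment> \<open>A real \<open>SUP\<close> is known to dominate its members only when they are
    bounded above; compactness of \<open>A\<close> and continuity of \<open>infdist\<close> ensure
    this.\<close>
  have "bdd_above ((\<lambda>a. infdist a B) ` A)"
    by (intro bounded_imp_bdd_above compact_imp_bounded compact_continuous_image
          continuous_intros assms(1))
  then have "infdist a B \<le> semidist A B"
    unfolding semidist_def using assms(2) by (rule cSUP_upper[rotated])
  then show ?thesis by (simp add: hausdorff_dist_def)
qed

section \<open>Grids and projections onto them\<close>

lemma norm_cart_le_sqrt_card:
  fixes x :: "real ^ 'n"
  assumes "\<And>i. \<bar>x $ i\<bar> \<le> r" and "r \<ge> 0"
  shows "norm x \<le> sqrt (real CARD('n)) * r"
proof -
  have "(\<Sum>i\<in>UNIV. (norm (x $ i))\<^sup>2) \<le> real CARD('n) * r\<^sup>2"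
    by (rule sum_bounded_above) (simp add: abs_le_square_iff[symmetric] assms)
  then have "norm x \<le> sqrt (real CARD('n) * r\<^sup>2)"
    unfolding norm_vec_def L2_set_def by (rule real_sqrt_le_mono)
  then show ?thesis using \<open>r \<ge> 0\<close> by (simp add: real_sqrt_mult)
qed

text \<open>Rounding the coordinates of \<open>x / \<rho>\<close> to nearest integers moves each
  coordinate of \<open>x\<close> by at most \<open>\<rho> / 2\<close>; the bound is half the
  diagonal of a grid cell.\<close>

lemma ex_grid_near:
  fixes x :: "real ^ 'n"
  assumes "\<rho> > 0"
  obtains p where "p \<in> grid \<rho>" "dist p x \<le> sqrt (real CARD('n)) / 2 * \<rho>"
proof
  \<comment> \<open>The rounded coordinates are collected into an integer vector first, so that
    \<open>p\<close> literally has the form required by \<open>grid\<close>.\<close>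
  define p :: "real ^ 'n" where "p = \<rho> *\<^sub>R (\<chi> i. of_int ((\<chi> i. round (x $ i / \<rho>)) $ i))"
  show "p \<in> grid \<rho>" unfolding grid_def p_def by (rule rangeI)
  have "\<bar>(p - x) $ i\<bar> \<le> \<rho> / 2" for i
  proof -
    have "(p - x) $ i = \<rho> * (of_int (round (x $ i / \<rho>)) - x $ i / \<rho>)"
      using assms by (simp add: p_def field_simps)
    moreover have "\<bar>of_int (round (x $ i / \<rho>)) - x $ i / \<rho>\<bar> \<le> 1 / 2"
      by (rule of_int_round_abs_le)
    ultimately show ?thesis using assms by (simp add: abs_mult)
  qed
  then show "dist p x \<le> sqrt (real CARD('n)) / 2 * \<rho>"
    using norm_cart_le_sqrt_card[of "p - x" "\<rho> / 2"] assms by (simp add: dist_norm)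
qed

text \<open>A grid point is at most as far from \<open>A\<close> as from \<open>a\<close>. Hence
  projections of nonempty sets are nonempty, and the discretized scheme never breaks off.\<close>

lemma ex_grid_proj_near:
  fixes a :: "real ^ 'n"
  assumes "\<rho> > 0" "a \<in> A"
  obtains p where "p \<in> grid_proj \<rho> A" "dist p a \<le> sqrt (real CARD('n)) / 2 * \<rho>"
proof -
  obtain p where "p \<in> grid \<rho>" "dist p a \<le> sqrt (real CARD('n)) / 2 * \<rho>"
    using ex_grid_near[OF assms(1)] .
  moreover from this(2) have "infdist p A \<le> sqrt (real CARD('n)) / 2 * \<rho>"
    using infdist_le[OF assms(2)] by (rule order_trans[rotated])
  ultimately show ?thesis
    using that assms(2) unfolding grid_proj_def by blast
qed

text \<open>Grid points closer than \<open>\<rho>\<close> coincide, because their integer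
  coordinates differ by less than 1; such uniformly discrete sets are closed.\<close>

lemma closed_grid:
  assumes "\<rho> > 0"
  shows "closed (grid \<rho> :: (real ^ 'n) set)"
proof (rule discrete_imp_closed[OF assms], intro ballI impI)
  fix x y :: "real ^ 'n"
  assume "x \<in> grid \<rho>" "y \<in> grid \<rho>" and near: "dist y x < \<rho>"
  then obtain k l :: "int ^ 'n" where x: "x = \<rho> *\<^sub>R (\<chi> i. of_int (k $ i))"
    and y: "y = \<rho> *\<^sub>R (\<chi> i. of_int (l $ i))" by (auto simp: grid_def)
  have "l $ i = k $ i" for i
  proof -
    have "\<rho> * \<bar>of_int (l $ i - k $ i)\<bar> = \<bar>(y - x) $ i\<bar>"
      using assms by (simp add: x y abs_mult right_diff_distrib[symmetric])
    also have "\<dots> < \<rho> * 1"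
      using component_le_norm_cart[of "y - x" i] near by (simp add: dist_norm)
    finally have "\<bar>of_int (l $ i - k $ i) :: real\<bar> < 1" using assms by simp
    then show ?thesis by linarith
  qed
  then show "y = x" by (simp add: x y)
qed

lemma closed_grid_proj:
  assumes "\<rho> > 0"
  shows "closed (grid_proj \<rho> (A :: (real ^ 'n) set))"
proof (cases "A = {}")
  case False
  then have "grid_proj \<rho> A = grid \<rho> \<inter> {x. infdist x A \<le> sqrt (real CARD('n)) / 2 * \<rho>}"
    by (auto simp: grid_proj_def)
  then show ?thesis
    by (auto intro!: closed_Int closed_grid assms closed_Collect_le continuous_intros)
qed (simp add: grid_proj_def)

text \<open>The velocity is recovered from \<open>z\<close> by a continuous map, so the solution set
  is a preimage of \<open>P\<close>. Closedness lets the distance to a nonempty solution set be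
  attained.\<close>

lemma closed_implicit_solutions:
  fixes g :: "'a::real_normed_vector \<Rightarrow> 'a"
  assumes "closed P" "continuous_on UNIV g" "h \<noteq> 0"
  shows "closed {z. z \<in> (\<lambda>m. x + h *\<^sub>R g z + h *\<^sub>R m) ` P}"
proof -
  have "z = x + h *\<^sub>R g z + h *\<^sub>R m \<longleftrightarrow> (z - x - h *\<^sub>R g z) /\<^sub>R h = m" for z m
  proof -
    have "z = x + h *\<^sub>R g z + h *\<^sub>R m \<longleftrightarrow> z - x - h *\<^sub>R g z = h *\<^sub>R m"
      by (auto simp: algebra_simps)
    also have "\<dots> \<longleftrightarrow> (z - x - h *\<^sub>R g z) /\<^sub>R h = m"
      using \<open>h \<noteq> 0\<close> by (metis divideR_right)
    finally show ?thesis .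
  qed
  then have "{z. z \<in> (\<lambda>m. x + h *\<^sub>R g z + h *\<^sub>R m) ` P} = (\<lambda>z. (z - x - h *\<^sub>R g z) /\<^sub>R h) -` P"
    by (auto simp: image_iff)
  then show ?thesis
    using assms by (auto intro!: closed_vimage continuous_intros)
qed

section \<open>Recursion for the error bound\<close>

lemma error_bound_0: "error_bound d l L t h \<rho> \<epsilon> 0 = sqrt (real d) / 2 * \<rho> 0"
  by (simp add: error_bound_def)

lemma error_bound_Suc:
  "error_bound d l L t h \<rho> \<epsilon> (Suc n) =
     (1 + L (t n) * h n) / (1 - l (t (Suc n)) * h n) * error_bound d l L t h \<rho> \<epsilon> n +
     sqrt (real d) / 2 * (\<rho> (Suc n) + \<epsilon> n * h n / (1 - l (t (Suc n)) * h n))"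
proof -
  define a where "a = (\<lambda>k. (1 + L (t k) * h k) / (1 - l (t (Suc k)) * h k))"
  define b where "b = (\<lambda>k. \<rho> (Suc k) + \<epsilon> k * h k / (1 - l (t (Suc k)) * h k))"
  have E: "error_bound d l L t h \<rho> \<epsilon> m = sqrt (real d) / 2 * \<rho> 0 * (\<Prod>k<m. a k) +
      sqrt (real d) / 2 * (\<Sum>k<m. (\<Prod>j\<in>{Suc k..<m}. a j) * b k)" for m
    by (simp add: error_bound_def a_def b_def)
  \<comment> \<open>For \<open>k < n\<close> the product contains the factor \<open>a n\<close>,
    which is pulled out; for \<open>k = n\<close> it is empty, so the new summand is
    \<open>b n\<close> alone.\<close>
  have "(\<Sum>k<n. (\<Prod>j\<in>{Suc k..<Suc n}. a j) * b k) = a n * (\<Sum>k<n. (\<Prod>j\<in>{Suc k..<n}. a j) * b k)"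
    unfolding sum_distrib_left by (intro sum.cong refl) (simp add: prod.atLeastLessThan_Suc)
  then have "error_bound d l L t h \<rho> \<epsilon> (Suc n) =
      a n * error_bound d l L t h \<rho> \<epsilon> n + sqrt (real d) / 2 * b n"
    unfolding E by (simp add: algebra_simps)
  then show ?thesis by (simp only: a_def b_def)
qed

section \<open>Step-by-step construction of a companion sequence\<close>

lemma ex_tracking_sequence:
  assumes "x0 \<in> X" "D 0 x0"
    and step: "\<And>n x. n < N \<Longrightarrow> D n x \<Longrightarrow> \<exists>x'\<in>S n x. D (Suc n) x'"
  shows "\<exists>x. x 0 \<in> X \<and> (\<forall>n<N. x (Suc n) \<in> S n (x n)) \<and> (\<forall>n\<le>N. D n (x n))"
proof -
  \<comment> \<open>Steps are available only for \<open>n < N\<close>: the guards let the choice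
    continue arbitrarily beyond \<open>N\<close>, and the clause for \<open>n = 0\<close> carries
    the initial condition.\<close>
  have "\<exists>x. \<forall>n. ((n = 0 \<longrightarrow> x n \<in> X) \<and> (n \<le> N \<longrightarrow> D n (x n))) \<and> (n < N \<longrightarrow> x (Suc n) \<in> S n (x n))"
  proof (rule dependent_nat_choice)
    fix x n
    assume "(n = 0 \<longrightarrow> x \<in> X) \<and> (n \<le> N \<longrightarrow> D n x)"
    then show "\<exists>y. ((Suc n = 0 \<longrightarrow> y \<in> X) \<and> (Suc n \<le> N \<longrightarrow> D (Suc n) y)) \<and> (n < N \<longrightarrow> y \<in> S n x)"
      using step[of n x] by (cases "n < N") auto
  qed (use assms in auto)
  then show ?thesis by auto
qed

section \<open>Estimates for a single step\<close>

text \<open>One step with frozen times: \<open>g\<close> stands for \<open>f (t (Suc n))\<close>,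
  \<open>A\<close> for \<open>M (t n)\<close>, and \<open>l\<close>, \<open>L\<close> for the values
  of \<open>l_f\<close>, \<open>L_M\<close> at these times.\<close>

locale euler_step =
  fixes g :: "real ^ 'n \<Rightarrow> real ^ 'n" and A :: "real ^ 'n \<Rightarrow> (real ^ 'n) set"
    and h l L :: real
  assumes h_pos: "h > 0"
    and restriction: "l * h < 1"
    and g_cont: "continuous_on UNIV g"
    and g_osl: "(g x - g x') \<bullet> (x - x') \<le> l * (norm (x - x'))\<^sup>2"
    and A_nonempty: "A x \<noteq> {}"
    and A_compact: "compact (A x)"
    and A_lipschitz: "hausdorff_dist (A x) (A x') \<le> L * norm (x - x')"
begin

lemma scaled_osl: "(h *\<^sub>R g x - h *\<^sub>R g x') \<bullet> (x - x') \<le> l * h * (norm (x - x'))\<^sup>2"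
  using mult_left_mono[OF g_osl[of x x'], of h] h_pos
  by (simp add: scaleR_diff_right[symmetric] mult_ac)

lemma ex_step: "\<exists>z. z = x + h *\<^sub>R g z + h *\<^sub>R m"
proof -
  have "continuous_on UNIV (\<lambda>z. h *\<^sub>R g z)" by (intro continuous_intros g_cont)
  then obtain z where "z = (x + h *\<^sub>R m) + h *\<^sub>R g z"
    using ex_implicit_solution[OF _ scaled_osl restriction] by blast
  then show ?thesis by (metis add.assoc add.commute)
qed

text \<open>The explicit part \<open>x + h *\<^sub>R m\<close> is the data of the implicit equation,
  so its perturbation is divided by \<open>1 - l * h\<close>. The slack \<open>\<delta>\<close>
  admits velocities rounded to a grid.\<close>

lemma step_stable:
  assumes "z = x + h *\<^sub>R g z + h *\<^sub>R m" "z' = x' + h *\<^sub>R g z' + h *\<^sub>R m'"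
    and "norm (m - m') \<le> L * norm (x - x') + \<delta>"
  shows "norm (z - z') \<le> (1 + L * h) / (1 - l * h) * norm (x - x') + \<delta> * h / (1 - l * h)"
proof -
  have "(1 - l * h) * norm (z - z') \<le> norm ((x + h *\<^sub>R m) - (x' + h *\<^sub>R m'))"
    using assms(1,2) by (intro implicit_solution_stable[OF scaled_osl]) (simp_all add: add_ac)
  also have "\<dots> = norm ((x - x') + h *\<^sub>R (m - m'))" by (simp add: algebra_simps)
  also have "\<dots> \<le> norm (x - x') + h * norm (m - m')"
    using norm_triangle_ineq[of "x - x'" "h *\<^sub>R (m - m')"] h_pos by simp
  also have "\<dots> \<le> norm (x - x') + h * (L * norm (x - x') + \<delta>)"
    using mult_left_mono[OF assms(3)] h_pos by simp
  finally have "norm (z - z') \<le> (norm (x - x') + h * (L * norm (x - x') + \<delta>)) / (1 - l * h)"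
    using restriction by (simp add: pos_le_divide_eq mult.commute)
  then show ?thesis by (simp add: add_divide_distrib algebra_simps)
qed

lemma ex_velocity_near:
  assumes "m \<in> A x"
  obtains m' where "m' \<in> A x'" "norm (m - m') \<le> L * norm (x - x')"
proof -
  have "infdist m (A x') \<le> L * norm (x - x')"
    using infdist_le_hausdorff_dist[OF A_compact assms] A_lipschitz by (rule order_trans)
  then show ?thesis
    using infdist_attained_le[OF compact_imp_closed[OF A_compact] A_nonempty] that
    unfolding dist_norm by blast
qed

context
  fixes \<rho> \<epsilon> :: real
  assumes \<rho>_pos: "\<rho> > 0" and \<epsilon>_pos: "\<epsilon> > 0"
begin

text \<open>The velocity is rounded before the implicit equation is solved, so
  \<open>\<epsilon>\<close> is multiplied by \<open>h / (1 - l * h)\<close>; the state is rounded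
  afterwards, so \<open>\<rho>\<close> enters directly.\<close>

lemma ex_discretized_step:
  assumes "z \<in> (\<lambda>m. x + h *\<^sub>R g z + h *\<^sub>R m) ` A x"
  shows "\<exists>z'\<in>grid_proj \<rho> {z. z \<in> (\<lambda>m. x' + h *\<^sub>R g z + h *\<^sub>R m) ` grid_proj \<epsilon> (A x')}.
    norm (z - z') \<le> (1 + L * h) / (1 - l * h) * norm (x - x') +
      sqrt (real CARD('n)) / 2 * (\<rho> + \<epsilon> * h / (1 - l * h))"
proof -
  obtain m where m: "m \<in> A x" "z = x + h *\<^sub>R g z + h *\<^sub>R m" using assms by auto
  obtain m' where m': "m' \<in> A x'" "norm (m - m') \<le> L * norm (x - x')"
    using ex_velocity_near[OF m(1)] .
  obtain p where p: "p \<in> grid_proj \<epsilon> (A x')" "dist p m' \<le> sqrt (real CARD('n)) / 2 * \<epsilon>"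
    using ex_grid_proj_near[OF \<epsilon>_pos m'(1)] .
  obtain w where w: "w = x' + h *\<^sub>R g w + h *\<^sub>R p" using ex_step by blast
  have "w \<in> {z. z \<in> (\<lambda>m. x' + h *\<^sub>R g z + h *\<^sub>R m) ` grid_proj \<epsilon> (A x')}"
    using w p(1) by blast
  then obtain q
    where q: "q \<in> grid_proj \<rho> {z. z \<in> (\<lambda>m. x' + h *\<^sub>R g z + h *\<^sub>R m) ` grid_proj \<epsilon> (A x')}"
      "dist q w \<le> sqrt (real CARD('n)) / 2 * \<rho>"
    using ex_grid_proj_near[OF \<rho>_pos] by meson
  have "norm (m - p) \<le> L * norm (x - x') + sqrt (real CARD('n)) / 2 * \<epsilon>"
    using norm_triangle_ineq[of "m - m'" "m' - p"] m'(2) p(2)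
    by (simp add: dist_norm norm_minus_commute)
  then have "norm (z - w) \<le> (1 + L * h) / (1 - l * h) * norm (x - x') +
      sqrt (real CARD('n)) / 2 * \<epsilon> * h / (1 - l * h)"
    by (rule step_stable[OF m(2) w])
  moreover have "norm (z - q) \<le> norm (z - w) + dist q w"
    using norm_triangle_ineq[of "z - w" "w - q"] by (simp add: dist_norm norm_minus_commute)
  ultimately have "norm (z - q) \<le> (1 + L * h) / (1 - l * h) * norm (x - x') +
      sqrt (real CARD('n)) / 2 * (\<rho> + \<epsilon> * h / (1 - l * h))"
    using q(2) by (simp add: algebra_simps)
  with q(1) show ?thesis by blast
qed

text \<open>Both roundings are undone in reverse order: from \<open>z'\<close> to an exact solution
  \<open>w\<close>, then from its grid velocity \<open>p\<close> to a velocity in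
  \<open>A x'\<close>, which is carried over to \<open>A x\<close>.\<close>

lemma ex_undiscretized_step:
  assumes "z' \<in> grid_proj \<rho> {z. z \<in> (\<lambda>m. x' + h *\<^sub>R g z + h *\<^sub>R m) ` grid_proj \<epsilon> (A x')}"
  shows "\<exists>z\<in>{z. z \<in> (\<lambda>m. x + h *\<^sub>R g z + h *\<^sub>R m) ` A x}.
    norm (z - z') \<le> (1 + L * h) / (1 - l * h) * norm (x - x') +
      sqrt (real CARD('n)) / 2 * (\<rho> + \<epsilon> * h / (1 - l * h))"
proof -
  let ?W = "{z. z \<in> (\<lambda>m. x' + h *\<^sub>R g z + h *\<^sub>R m) ` grid_proj \<epsilon> (A x')}"
  have "closed ?W"
    using h_pos by (intro closed_implicit_solutions closed_grid_proj \<epsilon>_pos g_cont) simp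
  \<comment> \<open>Nonemptiness is part of membership in \<open>grid_proj\<close>; together with
    closedness it yields a true nearest point of \<open>?W\<close>.\<close>
  moreover have "?W \<noteq> {}" "infdist z' ?W \<le> sqrt (real CARD('n)) / 2 * \<rho>"
    using assms unfolding grid_proj_def[of \<rho>] by simp_all
  ultimately obtain w where "w \<in> ?W" and w_near: "dist z' w \<le> sqrt (real CARD('n)) / 2 * \<rho>"
    by (rule infdist_attained_le)
  then obtain p where p: "p \<in> grid_proj \<epsilon> (A x')" and w: "w = x' + h *\<^sub>R g w + h *\<^sub>R p" by blast
  from p have "infdist p (A x') \<le> sqrt (real CARD('n)) / 2 * \<epsilon>" by (simp add: grid_proj_def)
  then obtain m' where m': "m' \<in> A x'" "dist p m' \<le> sqrt (real CARD('n)) / 2 * \<epsilon>"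
    by (rule infdist_attained_le[OF compact_imp_closed[OF A_compact] A_nonempty])
  obtain m where m: "m \<in> A x" "norm (m' - m) \<le> L * norm (x' - x)"
    using ex_velocity_near[OF m'(1)] .
  obtain z where z: "z = x + h *\<^sub>R g z + h *\<^sub>R m" using ex_step by blast
  have "norm (m - p) \<le> L * norm (x - x') + sqrt (real CARD('n)) / 2 * \<epsilon>"
    using norm_triangle_ineq[of "m - m'" "m' - p"] m'(2) m(2)
    by (simp add: dist_norm norm_minus_commute)
  then have "norm (z - w) \<le> (1 + L * h) / (1 - l * h) * norm (x - x') +
      sqrt (real CARD('n)) / 2 * \<epsilon> * h / (1 - l * h)"
    by (rule step_stable[OF z w])
  moreover have "norm (z - z') \<le> norm (z - w) + dist z' w"
    using norm_triangle_ineq[of "z - w" "w - z'"] by (simp add: dist_norm norm_minus_commute)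
  ultimately have "norm (z - z') \<le> (1 + L * h) / (1 - l * h) * norm (x - x') +
      sqrt (real CARD('n)) / 2 * (\<rho> + \<epsilon> * h / (1 - l * h))"
    using w_near by (simp add: algebra_simps)
  moreover have "z \<in> (\<lambda>m. x + h *\<^sub>R g z + h *\<^sub>R m) ` A x" using z m(1) by blast
  ultimately show ?thesis by blast
qed

end

end

section \<open>From single steps to the whole time grid\<close>

theorem proposition22:
  fixes T :: real
    and f :: "real \<Rightarrow> real ^ 'n \<Rightarrow> real ^ 'n"
    and M :: "real \<Rightarrow> real ^ 'n \<Rightarrow> (real ^ 'n) set"
    and l_f L_M :: "real \<Rightarrow> real"
    and x0 :: "real ^ 'n"
    and N :: nat
    and t h \<rho> \<epsilon> :: "nat \<Rightarrow> real"
  assumes T_pos: "T > 0"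
    and f_cont: "continuous_on ({0..T} \<times> UNIV) (\<lambda>(s, x). f s x)"
    and l_f_cont: "continuous_on {0..T} l_f"
    and f_osl: "\<And>s x x'. s \<in> {0..T} \<Longrightarrow>
      (f s x - f s x') \<bullet> (x - x') \<le> l_f s * (norm (x - x'))\<^sup>2"
    and M_values: "\<And>s x. s \<in> {0..T} \<Longrightarrow> M s x \<noteq> {} \<and> convex (M s x) \<and> compact (M s x)"
    and M_cont: "hausdorff_continuous_on ({0..T} \<times> UNIV) (\<lambda>(s, x). M s x)"
    and L_M_cont: "continuous_on {0..T} L_M"
    and L_M_nonneg: "\<And>s. s \<in> {0..T} \<Longrightarrow> L_M s \<ge> 0"
    and M_lipschitz: "\<And>s x x'. s \<in> {0..T} \<Longrightarrow>
      hausdorff_dist (M s x) (M s x') \<le> L_M s * norm (x - x')"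
    and t_start: "t 0 = 0"
    and t_end: "t N = T"
    and t_less: "\<And>n. n < N \<Longrightarrow> t n < t (Suc n)"
    and h_step: "\<And>n. n < N \<Longrightarrow> h n = t (Suc n) - t n"
    and step_restriction: "\<And>n. n < N \<Longrightarrow> l_f (t (Suc n)) * h n < 1"
    and \<rho>_pos: "\<And>n. n \<le> N \<Longrightarrow> \<rho> n > 0"
    and \<epsilon>_pos: "\<And>n. n < N \<Longrightarrow> \<epsilon> n > 0"
  shows "(\<forall>y \<in> euler_solutions f M x0 N t h.
           \<exists>y' \<in> discretized_solutions f M x0 N t h \<rho> \<epsilon>.
             \<forall>n\<le>N. norm (y n - y' n) \<le> error_bound CARD('n) l_f L_M t h \<rho> \<epsilon> n) \<and>
         (\<forall>y' \<in> discretized_solutions f M x0 N t h \<rho> \<epsilon>.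
           \<exists>y \<in> euler_solutions f M x0 N t h.
             \<forall>n\<le>N. norm (y n - y' n) \<le> error_bound CARD('n) l_f L_M t h \<rho> \<epsilon> n)"
proof -
  let ?E = "error_bound CARD('n) l_f L_M t h \<rho> \<epsilon>"
  \<comment> \<open>Downward induction from \<open>n\<close> to \<open>m\<close>: all steps used
    start below \<open>n\<close>, hence below \<open>N\<close>, where \<open>t_less\<close>
    applies.\<close>
  have t_mono: "t m \<le> t n" if "m \<le> n" "n \<le> N" for m n
    by (rule inc_induct[OF that(1)], simp, meson t_less less_le_trans less_imp_le order_trans that(2))
  have t_in: "t n \<in> {0..T}" if "n \<le> N" for n
    using t_mono[of 0 n] t_mono[of n N] that t_start t_end by simp
  have f_cont_at: "continuous_on UNIV (f s)" if "s \<in> {0..T}" for s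
  proof -
    have "continuous_on UNIV ((\<lambda>(s, x). f s x) \<circ> Pair s)"
      using that by (intro continuous_on_compose continuous_on_subset[OF f_cont] continuous_intros) auto
    then show ?thesis by (simp add: comp_def)
  qed
  have h_pos: "h n > 0" if "n < N" for n using that h_step t_less by simp
  have t_h: "t n + h n = t (Suc n)" if "n < N" for n using that h_step by simp
  have step: "euler_step (f (t (Suc n))) (M (t n)) (h n) (l_f (t (Suc n))) (L_M (t n))"
    if "n < N" for n
    using that h_pos step_restriction f_cont_at f_osl M_values M_lipschitz
      t_in[of n] t_in[of "Suc n"] by unfold_locales simp_all
  have E_Suc: "(1 + L_M (t n) * h n) / (1 - l_f (t (Suc n)) * h n) * e +
      sqrt (real CARD('n)) / 2 * (\<rho> (Suc n) + \<epsilon> n * h n / (1 - l_f (t (Suc n)) * h n)) \<le> ?E (Suc n)"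
    if "n < N" "e \<le> ?E n" for n e
  proof -
    \<comment> \<open>The sign of the factor is what permits replacing the error \<open>e\<close> by
      its bound \<open>?E n\<close>.\<close>
    have "(1 + L_M (t n) * h n) / (1 - l_f (t (Suc n)) * h n) \<ge> 0"
      using that(1) L_M_nonneg[OF t_in[of n]] h_pos[of n] step_restriction[of n] by simp
    then show ?thesis
      using mult_left_mono[OF that(2)] by (simp only: error_bound_Suc add_le_cancel_right)
  qed
  have forward: "\<exists>y' \<in> discretized_solutions f M x0 N t h \<rho> \<epsilon>. \<forall>n\<le>N. norm (y n - y' n) \<le> ?E n"
    if y: "y \<in> euler_solutions f M x0 N t h" for y
  proof -
    obtain q where q: "q \<in> grid_proj (\<rho> 0) {x0}" "dist q x0 \<le> sqrt (real CARD('n)) / 2 * \<rho> 0"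
      using ex_grid_proj_near[OF \<rho>_pos[of 0], of x0 "{x0}"] by auto
    \<comment> \<open>Here \<open>y\<close> is given and \<open>y'\<close> is chosen; the invariant
      is that the current state lies within \<open>?E n\<close> of \<open>y n\<close>.\<close>
    have "\<exists>y'. y' 0 \<in> grid_proj (\<rho> 0) {x0} \<and>
      (\<forall>n<N. y' (Suc n) \<in> discretized_euler f M (t n) (y' n) (h n) (\<rho> (Suc n)) (\<epsilon> n)) \<and>
      (\<forall>n\<le>N. norm (y n - y' n) \<le> ?E n)"
    proof (rule ex_tracking_sequence[OF q(1)])
      show "norm (y 0 - q) \<le> ?E 0"
        using y q(2) by (simp add: euler_solutions_def error_bound_0 dist_norm norm_minus_commute)
    next
      fix n x'
      assume n: "n < N" and near: "norm (y n - x') \<le> ?E n"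
      interpret euler_step "f (t (Suc n))" "M (t n)" "h n" "l_f (t (Suc n))" "L_M (t n)"
        by (rule step[OF n])
      have "y (Suc n) \<in> (\<lambda>m. y n + h n *\<^sub>R f (t (Suc n)) (y (Suc n)) + h n *\<^sub>R m) ` M (t n) (y n)"
        using y n by (auto simp: euler_solutions_def semi_implicit_euler_def t_h)
      from ex_discretized_step[OF _ _ this, of "\<rho> (Suc n)" "\<epsilon> n" x']
      show "\<exists>z'\<in>discretized_euler f M (t n) x' (h n) (\<rho> (Suc n)) (\<epsilon> n). norm (y (Suc n) - z') \<le> ?E (Suc n)"
        unfolding discretized_euler_def t_h[OF n]
        using \<rho>_pos[of "Suc n"] \<epsilon>_pos[OF n] n E_Suc[OF n near] by (meson Suc_leI order_trans)
    qed
    then show ?thesis by (auto simp: discretized_solutions_def)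
  qed
  have backward: "\<exists>y \<in> euler_solutions f M x0 N t h. \<forall>n\<le>N. norm (y n - y' n) \<le> ?E n"
    if y': "y' \<in> discretized_solutions f M x0 N t h \<rho> \<epsilon>" for y'
  proof -
    \<comment> \<open>The roles are exchanged: \<open>y'\<close> is given and \<open>y\<close> is
      chosen, with the singleton \<open>{x0}\<close> as the set of initial states.\<close>
    have "\<exists>y. y 0 \<in> {x0} \<and> (\<forall>n<N. y (Suc n) \<in> semi_implicit_euler f M (t n) (y n) (h n)) \<and>
      (\<forall>n\<le>N. norm (y n - y' n) \<le> ?E n)"
    proof (rule ex_tracking_sequence)
      \<comment> \<open>For a singleton \<open>infdist\<close> is the distance itself, so the
        initial bound is contained in \<open>y' 0 \<in> grid_proj (\<rho> 0) {x0}\<close>.\<close>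
      show "norm (x0 - y' 0) \<le> ?E 0"
        using y' by (simp add: discretized_solutions_def grid_proj_def error_bound_0 dist_norm
            norm_minus_commute)
    next
      fix n x
      assume n: "n < N" and near: "norm (x - y' n) \<le> ?E n"
      interpret euler_step "f (t (Suc n))" "M (t n)" "h n" "l_f (t (Suc n))" "L_M (t n)"
        by (rule step[OF n])
      have "y' (Suc n) \<in> discretized_euler f M (t n) (y' n) (h n) (\<rho> (Suc n)) (\<epsilon> n)"
        using y' n by (simp add: discretized_solutions_def)
      then have "y' (Suc n) \<in> grid_proj (\<rho> (Suc n)) {z. z \<in> (\<lambda>m. y' n + h n *\<^sub>R f (t (Suc n)) z
          + h n *\<^sub>R m) ` grid_proj (\<epsilon> n) (M (t n) (y' n))}"
        by (simp only: discretized_euler_def t_h[OF n])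
      from ex_undiscretized_step[OF _ _ this, of x]
      show "\<exists>z\<in>semi_implicit_euler f M (t n) x (h n). norm (z - y' (Suc n)) \<le> ?E (Suc n)"
        unfolding semi_implicit_euler_def t_h[OF n]
        using \<rho>_pos[of "Suc n"] \<epsilon>_pos[OF n] n E_Suc[OF n near] by (meson Suc_leI order_trans)
    qed simp
    then show ?thesis by (auto simp: euler_solutions_def)
  qed
  from forward backward show ?thesis by blast
qed

end
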